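(* Let $t_h(\cdot,\cdot)$ be a scalar product on $\mathbb{V}_h(\Sigma)$, and define the linear map $\Pi:\mathbb{V}_h(\Sigma)\to\mathbb{V}_h(\Sigma)$ by requiring that $(\mathrm{Id}+\Pi)/2$ be the orthogonal projector onto the subspace $V_h(\Sigma)\subset \mathbb{V}_h(\Sigma)$ for the scalar product $t_h$. Then $\Pi$ is an isometry: $\Pi^2=\mathrm{Id}$ and $\|\Pi(\mathfrak{u})\|_{t_h}=\|\mathfrak{u}\|_{t_h}$ for all $\mathfrak{u}\in\mathbb{V}_h(\Sigma)$. Moreover, for any pair $(\mathfrak{u},\mathfrak{q})\in\mathbb{V}_h(\Sigma)\times\mathbb{V}_h(\Sigma)$, $$(\mathfrak{u},\mathfrak{q})\in V_h(\Sigma)\times V_h(\Sigma)^{\perp}\quad\iff\quad -\mathfrak{q}+i\,\mathfrak{u}=\Pi(\mathfrak{q}+i\,\mathfrak{u}).$$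
   Context: Let $d\in\{1,2,3\}$ and let $\Omega\subset\mathbb{R}^d$ be a bounded polygonal/polyhedral domain with a regular simplicial triangulation $\mathcal{T}_h(\Omega)$. For a fixed $k\ge1$, $V_h(\Omega)$ is the space of complex-valued continuous functions on $\overline\Omega$ whose restriction to each $\tau\in\mathcal{T}_h(\Omega)$ is a polynomial of degree at most $k$. The domain is partitioned as $\overline\Omega=\cup_{j=1}^J\overline{\Omega}_j^h$ with pairwise disjoint polyhedral subdomains $\Omega_j^h\subset\Omega$, each exactly resolved by the triangulation (its closure is a union of closed mesh cells). Set $\Gamma_j^h:=\partial\Omega_j^h$, $\Sigma:=\cup_j\Gamma_j^h$, $V_h(\Gamma_j^h):=\{v|_{\Gamma_j^h}: v\in V_h(\Omega)\}$. Cross-points (points shared by three or more subdomains) are allowed. The multi-trace space is $\mathbb{V}_h(\Sigma):=V_h(\Gamma_1^h)\times\cdots\times V_h(\Gamma_J^h)$, and the single-trace space is its subspace $V_h(\Sigma):=\{(v|_{\Gamma_1^h},\dots,v|_{\Gamma_J^h}): v\in V_h(\Omega)\}$. A scalar product is a Hermitian positive definite sesquilinear form; $\|\mathfrak{w}\|_{t_h}:=\sqrt{t_h(\mathfrak{w},\mathfrak{w})}$, and $V_h(\Sigma)^\perp:=\{\mathfrak{u}\in\mathbb{V}_h(\Sigma): t_h(\mathfrak{u},\mathfrak{v})=0\ \forall\mathfrak{v}\in V_h(\Sigma)\}$. *)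

theory Defs
  imports "HOL-Analysis.Analysis" "HOL-Library.Function_Algebras"
begin

section \<open>Geometry\<close>

text \<open>A bounded polygonal or polyhedral open set: its boundary is a finite union of flat pieces
  of codimension one (points if $d = 1$, segments if $d = 2$, convex polygons if $d = 3$).
  Connectedness is not included; a polyhedral domain is a connected polyhedral open set.\<close>

definition polyhedral_open :: "(real ^ 'd) set \<Rightarrow> bool" where
  "polyhedral_open S \<longleftrightarrow>
     open S \<and> bounded S \<and> S \<noteq> {} \<and>
     (\<exists>F. finite F \<and> (\<forall>f\<in>F. polytope f \<and> aff_dim f = int CARD('d) - 1) \<and> frontier S = \<Union>F)"

text \<open>The cells are closed nondegenerate \<open>d\<close>-simplices; \<^const>\<open>triangulation\<close> says that there are
  finitely many of them and that any two meet in a common (possibly empty) face.\<close>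

definition simplicial_mesh :: "(real ^ 'd) set \<Rightarrow> (real ^ 'd) set set \<Rightarrow> bool" where
  "simplicial_mesh \<Omega> \<T> \<longleftrightarrow>
     triangulation \<T> \<and> (\<forall>\<tau>\<in>\<T>. int CARD('d) simplex \<tau>) \<and> closure \<Omega> = \<Union>\<T>"

text \<open>The subdomains are \<open>\<Omega>s 1, \<dots>, \<Omega>s J\<close>; values of \<open>\<Omega>s\<close> at other indices are irrelevant.\<close>

definition resolved_partition ::
    "(real ^ 'd) set \<Rightarrow> (real ^ 'd) set set \<Rightarrow> nat \<Rightarrow> (nat \<Rightarrow> (real ^ 'd) set) \<Rightarrow> bool" where
  "resolved_partition \<Omega> \<T> J \<Omega>s \<longleftrightarrow>
     (\<forall>j\<in>{1..J}. polyhedral_open (\<Omega>s j) \<and> \<Omega>s j \<subseteq> \<Omega> \<and> (\<exists>\<S>\<subseteq>\<T>. closure (\<Omega>s j) = \<Union>\<S>)) \<and>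
     disjoint_family_on \<Omega>s {1..J} \<and>
     closure \<Omega> = (\<Union>j\<in>{1..J}. closure (\<Omega>s j))"


section \<open>Finite element and trace spaces\<close>

definition complex_polys :: "nat \<Rightarrow> (real ^ 'd \<Rightarrow> complex) set" where
  "complex_polys k =
     {p. \<exists>c. \<forall>x. p x = (\<Sum>\<alpha> | sum \<alpha> (UNIV :: 'd set) \<le> k. c \<alpha> * complex_of_real (\<Prod>i\<in>UNIV. x $ i ^ \<alpha> i))}"

text \<open>A function on a subset \<open>S\<close> of $\mathbb{R}^d$ is represented by its extension by zero,
  so that the pointwise operations on the whole function type are those of functions on \<open>S\<close>.\<close>

definition restr :: "(real ^ 'd) set \<Rightarrow> (real ^ 'd \<Rightarrow> complex) \<Rightarrow> real ^ 'd \<Rightarrow> complex" where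
  "restr S v = (\<lambda>x. if x \<in> S then v x else 0)"

definition fe_space ::
    "nat \<Rightarrow> (real ^ 'd) set \<Rightarrow> (real ^ 'd) set set \<Rightarrow> (real ^ 'd \<Rightarrow> complex) set" where
  "fe_space k \<Omega> \<T> =
     {v. continuous_on (closure \<Omega>) v \<and> (\<forall>x. x \<notin> closure \<Omega> \<longrightarrow> v x = 0) \<and>
         (\<forall>\<tau>\<in>\<T>. \<exists>p\<in>complex_polys k. \<forall>x\<in>\<tau>. v x = p x)}"

definition fe_trace_space ::
    "nat \<Rightarrow> (real ^ 'd) set \<Rightarrow> (real ^ 'd) set set \<Rightarrow> (real ^ 'd) set \<Rightarrow> (real ^ 'd \<Rightarrow> complex) set" where
  "fe_trace_space k \<Omega> \<T> \<Gamma> = restr \<Gamma> ` fe_space k \<Omega> \<T>"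

text \<open>A \<open>J\<close>-tuple of traces is a family indexed by the naturals that is zero outside \<open>{1..J}\<close>.\<close>

type_synonym 'd traces = "nat \<Rightarrow> real ^ 'd \<Rightarrow> complex"

definition multi_trace_space ::
    "nat \<Rightarrow> (real ^ 'd) set \<Rightarrow> (real ^ 'd) set set \<Rightarrow> nat \<Rightarrow> (nat \<Rightarrow> (real ^ 'd) set) \<Rightarrow> 'd traces set" where
  "multi_trace_space k \<Omega> \<T> J \<Omega>s =
     {u. (\<forall>j\<in>{1..J}. u j \<in> fe_trace_space k \<Omega> \<T> (frontier (\<Omega>s j))) \<and> (\<forall>j. j \<notin> {1..J} \<longrightarrow> u j = 0)}"

definition single_trace_space ::
    "nat \<Rightarrow> (real ^ 'd) set \<Rightarrow> (real ^ 'd) set set \<Rightarrow> nat \<Rightarrow> (nat \<Rightarrow> (real ^ 'd) set) \<Rightarrow> 'd traces set" where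
  "single_trace_space k \<Omega> \<T> J \<Omega>s =
     (\<lambda>v j. if j \<in> {1..J} then restr (frontier (\<Omega>s j)) v else 0) ` fe_space k \<Omega> \<T>"


section \<open>Hermitian linear algebra on a space of traces\<close>

definition cscale :: "complex \<Rightarrow> 'd traces \<Rightarrow> 'd traces" (infixr \<open>*\<^sub>C\<close> 75) where
  "c *\<^sub>C u = (\<lambda>j x. c * u j x)"

definition linear_map_on :: "'d traces set \<Rightarrow> ('d traces \<Rightarrow> 'd traces) \<Rightarrow> bool" where
  "linear_map_on V F \<longleftrightarrow>
     F \<in> V \<rightarrow> V \<and>
     (\<forall>u\<in>V. \<forall>v\<in>V. F (u + v) = F u + F v) \<and>
     (\<forall>c. \<forall>u\<in>V. F (c *\<^sub>C u) = c *\<^sub>C F u)"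

text \<open>Linear in the first argument; with Hermitian symmetry this makes the form antilinear in the
  second argument and \<open>t u u\<close> real.\<close>

definition scalar_product_on :: "'d traces set \<Rightarrow> ('d traces \<Rightarrow> 'd traces \<Rightarrow> complex) \<Rightarrow> bool" where
  "scalar_product_on V t \<longleftrightarrow>
     (\<forall>u\<in>V. \<forall>v\<in>V. \<forall>w\<in>V. t (u + v) w = t u w + t v w) \<and>
     (\<forall>c. \<forall>u\<in>V. \<forall>w\<in>V. t (c *\<^sub>C u) w = c * t u w) \<and>
     (\<forall>u\<in>V. \<forall>w\<in>V. t w u = cnj (t u w)) \<and>
     (\<forall>u\<in>V. u \<noteq> 0 \<longrightarrow> Re (t u u) > 0)"

definition sp_norm :: "('d traces \<Rightarrow> 'd traces \<Rightarrow> complex) \<Rightarrow> 'd traces \<Rightarrow> real" where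
  "sp_norm t u = sqrt (Re (t u u))"

definition orth_complement ::
    "('d traces \<Rightarrow> 'd traces \<Rightarrow> complex) \<Rightarrow> 'd traces set \<Rightarrow> 'd traces set \<Rightarrow> 'd traces set" where
  "orth_complement t V W = {u\<in>V. \<forall>w\<in>W. t u w = 0}"

definition orth_projector_on ::
    "('d traces \<Rightarrow> 'd traces \<Rightarrow> complex) \<Rightarrow> 'd traces set \<Rightarrow> 'd traces set \<Rightarrow> ('d traces \<Rightarrow> 'd traces) \<Rightarrow> bool"
  where
  "orth_projector_on t V W P \<longleftrightarrow> (\<forall>u\<in>V. P u \<in> W \<and> u - P u \<in> orth_complement t V W)"

end

theory Submission
  imports Defs
begin

text \<open>If \<open>(1/2) (Id + \<pi>)\<close> is the orthogonal projector onto \<open>W\<close>, then \<open>\<pi>\<close> is the reflection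
  across \<open>W\<close>: writing an element of \<open>V\<close> as \<open>w + z\<close> with \<open>w \<in> W\<close> and \<open>z\<close> orthogonal to \<open>W\<close>, one has
  \<open>\<pi> (w + z) = w - z\<close> (lemma \<open>reflection_apply\<close>). Since the decomposition is unique, this single
  formula determines \<open>\<pi>\<close> on \<open>V\<close> and gives everything else. Changing the sign of \<open>z\<close> twice does
  nothing, so \<open>\<pi>\<close> is an involution. By Pythagoras the norm of \<open>w + z\<close> does not see the sign of \<open>z\<close>, so
  \<open>\<pi>\<close> preserves the norm. Finally, if \<open>q + \<i> u = w + z\<close>, then \<open>- q + \<i> u = w - z\<close> says, after adding
  and subtracting the two equations, that \<open>\<i> u = w\<close> and \<open>q = z\<close>.

  The existence of the projector rests on the finite dimension of \<open>W\<close>.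
  A finite element function is determined by its polynomial coefficients on the finitely many cells,
  so single traces lie in the span of the traces of finitely many cell-wise monomials
  (lemma \<open>single_trace_space_finitely_spanned\<close>); projections onto finitely spanned subspaces are then
  built by Gram--Schmidt orthogonalisation (lemma \<open>ex_orth_decomposition_span\<close>).\<close>

section \<open>Traces as a complex vector space\<close>

interpretation tr: vector_space "cscale :: complex \<Rightarrow> 'd traces \<Rightarrow> 'd traces"
  by unfold_locales (auto simp: cscale_def fun_eq_iff algebra_simps)

locale trace_inner_product =
  fixes V :: "'d traces set" and t :: "'d traces \<Rightarrow> 'd traces \<Rightarrow> complex"
  assumes subspace_V: "tr.subspace V" and sp: "scalar_product_on V t"
begin

lemmas V_closed = tr.subspace_add[OF subspace_V] tr.subspace_diff[OF subspace_V]
  tr.subspace_scale[OF subspace_V] tr.subspace_neg[OF subspace_V] tr.subspace_0[OF subspace_V]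

lemma add_left: "u \<in> V \<Longrightarrow> v \<in> V \<Longrightarrow> w \<in> V \<Longrightarrow> t (u + v) w = t u w + t v w"
  and scale_left: "u \<in> V \<Longrightarrow> w \<in> V \<Longrightarrow> t (c *\<^sub>C u) w = c * t u w"
  and commute: "u \<in> V \<Longrightarrow> w \<in> V \<Longrightarrow> t w u = cnj (t u w)"
  and positive: "u \<in> V \<Longrightarrow> u \<noteq> 0 \<Longrightarrow> Re (t u u) > 0"
  using sp[unfolded scalar_product_on_def] by metis+

lemma zero_left: "w \<in> V \<Longrightarrow> t 0 w = 0"
  using scale_left[of w w 0] by simp

lemma minus_left:
  assumes "u \<in> V" "w \<in> V" shows "t (- u) w = - t u w"
  using scale_left[OF assms, of "-1"] by simp

lemma diff_left:
  assumes "u \<in> V" "v \<in> V" "w \<in> V" shows "t (u - v) w = t u w - t v w"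
  using add_left[of u "- v" w] minus_left[of v w] assms V_closed(4)[of v] by simp

lemma add_right: "u \<in> V \<Longrightarrow> v \<in> V \<Longrightarrow> w \<in> V \<Longrightarrow> t w (u + v) = t w u + t w v"
  using commute[of "u + v" w] commute[of u w] commute[of v w] by (simp add: V_closed add_left)

lemma scale_right: "u \<in> V \<Longrightarrow> w \<in> V \<Longrightarrow> t w (c *\<^sub>C u) = cnj c * t w u"
  using commute[of "c *\<^sub>C u" w] commute[of u w] by (simp add: V_closed scale_left)

lemma definite: "u \<in> V \<Longrightarrow> t u u = 0 \<Longrightarrow> u = 0"
  using positive[of u] by force

lemma subspace_orth_complement:
  assumes "W \<subseteq> V" shows "tr.subspace (orth_complement t V W)"
  using assms unfolding tr.subspace_def orth_complement_def
  by (auto simp: subset_iff V_closed zero_left add_left scale_left)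

lemma pythagoras:
  assumes "w \<in> V" "z \<in> V" "t z w = 0"
  shows "t (w + z) (w + z) = t w w + t z z"
proof -
  have "t w z = 0" using commute[of z w] assms by simp
  then show ?thesis using assms by (simp add: V_closed add_left add_right)
qed

lemma orth_decomposition_unique:
  assumes "tr.subspace W" "W \<subseteq> V"
    and w: "w \<in> W" "w' \<in> W" and z: "z \<in> orth_complement t V W" "z' \<in> orth_complement t V W"
    and eq: "w + z = w' + z'"
  shows "w = w'" "z = z'"
proof -
  have d: "w - w' = z' - z" using eq by (simp add: algebra_simps)
  have "w - w' \<in> W" using assms(1) w by (rule tr.subspace_diff)
  moreover have "w - w' \<in> orth_complement t V W"
    unfolding d using subspace_orth_complement[OF assms(2)] z(2,1) by (rule tr.subspace_diff)
  ultimately have "w - w' \<in> V" "t (w - w') (w - w') = 0" by (auto simp: orth_complement_def)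
  then show "w = w'" using definite by fastforce
  then show "z = z'" using eq by simp
qed


section \<open>Existence of orthogonal decompositions\<close>

text \<open>Gram--Schmidt: the component \<open>e\<close> of the new vector \<open>b\<close> orthogonal to the span of \<open>B\<close> is
  the only direction along which the decomposition relative to \<open>B\<close> has to be corrected.\<close>

lemma ex_orth_decomposition_span:
  assumes "finite B" "B \<subseteq> V" "u \<in> V"
  shows "\<exists>w\<in>tr.span B. u - w \<in> orth_complement t V (tr.span B)"
  using assms
proof (induction B arbitrary: u rule: finite_induct)
  case empty
  have "t u 0 = 0" using scale_right[of u u 0] empty by simp
  with empty show ?case by (simp add: orth_complement_def)
next
  case (insert b B)
  have BV: "B \<subseteq> V" and bV: "b \<in> V" using insert.prems by auto
  have spV: "tr.span B \<subseteq> V" using tr.span_minimal[OF BV subspace_V] .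
  obtain w where w: "w \<in> tr.span B" and uw: "u - w \<in> orth_complement t V (tr.span B)"
    using insert.IH[OF BV insert.prems(2)] by blast
  obtain p where p: "p \<in> tr.span B" and bp: "b - p \<in> orth_complement t V (tr.span B)"
    using insert.IH[OF BV bV] by blast
  define e where "e = b - p"
  have eV: "e \<in> V" using bp by (simp add: e_def orth_complement_def)
  have uwV: "u - w \<in> V" using uw by (simp add: orth_complement_def)
  (* If e = 0 then c = 0 by division by zero, which is the right value: b brings nothing new. *)
  define c where "c = t (u - w) e / t e e"
  let ?r = "u - w - c *\<^sub>C e"
  have rV: "?r \<in> V" using eV uwV by (simp add: V_closed)
  have "t ?r e = 0"
  proof (cases "e = 0")
    case True
    then show ?thesis using rV zero_left[OF rV] commute[of e ?r] eV by simp
  next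
    case False
    then have "t e e \<noteq> 0" using definite[OF eV] by blast
    then show ?thesis using eV uwV by (simp add: c_def V_closed diff_left scale_left)
  qed
  moreover have rB: "t ?r x = 0" if "x \<in> tr.span B" for x
    using that uw bp spV eV uwV
    by (auto simp: subset_iff orth_complement_def e_def[symmetric] V_closed diff_left scale_left)
  ultimately have "t ?r x = 0" if x: "x \<in> tr.span (insert b B)" for x
  proof -
    obtain a where a: "x - a *\<^sub>C b \<in> tr.span B" using x by (auto simp: tr.span_breakdown_eq)
    define y where "y = x - a *\<^sub>C b + a *\<^sub>C p"
    have y: "y \<in> tr.span B" unfolding y_def using a p by (simp add: tr.span_add tr.span_scale)
    have "x = y + a *\<^sub>C e" by (simp add: y_def e_def tr.scale_right_diff_distrib)
    then show ?thesis
      using \<open>t ?r e = 0\<close> rB[OF y] y spV eV rV by (auto simp: V_closed add_right scale_right)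
  qed
  moreover have "w + c *\<^sub>C e \<in> tr.span (insert b B)"
  proof -
    have "tr.span B \<subseteq> tr.span (insert b B)" by (rule tr.span_mono) auto
    then show ?thesis unfolding e_def using w p
      by (intro tr.span_add tr.span_scale tr.span_diff) (auto intro: tr.span_base)
  qed
  ultimately show ?case
    using rV unfolding orth_complement_def
    by (intro bexI[of _ "w + c *\<^sub>C e"]) (simp_all only: diff_diff_eq mem_Collect_eq, blast)
qed

lemma ex_orth_decomposition:
  assumes "tr.subspace W" "W \<subseteq> V" "finite G" "W \<subseteq> tr.span G" "u \<in> V"
  shows "\<exists>w\<in>W. u - w \<in> orth_complement t V W"
proof -
  obtain B where B: "B \<subseteq> W" "tr.independent B" "W \<subseteq> tr.span B"
    using tr.maximal_independent_subset by blast
  have "tr.span B = W" using B tr.span_minimal[OF _ assms(1)] by blast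
  moreover have "finite B"
    using tr.independent_span_bound[OF assms(3) B(2)] B(1) assms(4) by blast
  ultimately show ?thesis
    using ex_orth_decomposition_span[of B u] B(1) assms(2,5) by simp
qed


section \<open>The reflection across a subspace\<close>

text \<open>Both sides of \<open>(1/2) (w + z + \<pi> (w + z)) = w\<close> are the \<open>W\<close>-component of \<open>w + z\<close>.\<close>

lemma reflection_apply:
  assumes W: "tr.subspace W" "W \<subseteq> V"
    and P: "orth_projector_on t V W (\<lambda>u. (1/2) *\<^sub>C (u + \<pi> u))"
    and w: "w \<in> W" and z: "z \<in> orth_complement t V W"
  shows "\<pi> (w + z) = w - z"
proof -
  have "w + z \<in> V" using w z W(2) by (auto simp: orth_complement_def V_closed)
  then have *: "(1/2) *\<^sub>C (w + z + \<pi> (w + z)) \<in> W"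
    "w + z - (1/2) *\<^sub>C (w + z + \<pi> (w + z)) \<in> orth_complement t V W"
    using P by (auto simp: orth_projector_on_def)
  have "w = (1/2) *\<^sub>C (w + z + \<pi> (w + z))"
    by (rule orth_decomposition_unique(1)[OF W w *(1) z *(2)]) simp
  then have "2 *\<^sub>C w = 2 *\<^sub>C ((1/2) *\<^sub>C (w + z + \<pi> (w + z)))" by (rule arg_cong)
  then have "w + w = w + z + \<pi> (w + z)"
    using tr.scale_left_distrib[of 1 1 w] by simp
  then show ?thesis by (simp add: algebra_simps)
qed

lemma projector_decomposition:
  assumes "orth_projector_on t V W P" "u \<in> V"
  obtains w z where "w \<in> W" "z \<in> orth_complement t V W" "u = w + z"
  using assms that[of "P u" "u - P u"] by (auto simp: orth_projector_on_def)

lemma reflection_involutive: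
  assumes W: "tr.subspace W" "W \<subseteq> V"
    and P: "orth_projector_on t V W (\<lambda>u. (1/2) *\<^sub>C (u + \<pi> u))" and "u \<in> V"
  shows "\<pi> (\<pi> u) = u"
proof -
  obtain w z where wz: "w \<in> W" "z \<in> orth_complement t V W" "u = w + z"
    using projector_decomposition[OF P \<open>u \<in> V\<close>] .
  have "- z \<in> orth_complement t V W"
    using subspace_orth_complement[OF W(2)] wz(2) by (rule tr.subspace_neg)
  then show ?thesis
    using reflection_apply[OF W P wz(1,2)] reflection_apply[OF W P wz(1), of "- z"] wz(3) by simp
qed

lemma reflection_isometry:
  assumes W: "tr.subspace W" "W \<subseteq> V"
    and P: "orth_projector_on t V W (\<lambda>u. (1/2) *\<^sub>C (u + \<pi> u))" and "u \<in> V"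
  shows "sp_norm t (\<pi> u) = sp_norm t u"
proof -
  obtain w z where wz: "w \<in> W" "z \<in> orth_complement t V W" "u = w + z"
    using projector_decomposition[OF P \<open>u \<in> V\<close>] .
  have V: "w \<in> V" "z \<in> V" "- z \<in> V" and 0: "t z w = 0"
    using wz W(2) by (auto simp: orth_complement_def V_closed)
  have "t (- z) (- z) = t z z"
    using V scale_right[of z "- z" "-1"] by (simp add: minus_left)
  then have "t (w - z) (w - z) = t (w + z) (w + z)"
    using V 0 pythagoras[of w "- z"] pythagoras[of w z]
    by (simp add: minus_left)
  then show ?thesis using reflection_apply[OF W P wz(1,2)] wz(3) by (simp add: sp_norm_def)
qed

text \<open>Multiplying \<open>u\<close> by \<open>\<i>\<close> is harmless because \<open>W\<close> is a complex subspace; the splitting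
  \<open>q + \<i> u = w + z\<close> then encodes the two membership conditions in one equation.\<close>

lemma reflection_transmission_iff:
  assumes W: "tr.subspace W" "W \<subseteq> V"
    and P: "orth_projector_on t V W (\<lambda>u. (1/2) *\<^sub>C (u + \<pi> u))" and u: "u \<in> V" and q: "q \<in> V"
  shows "(u, q) \<in> W \<times> orth_complement t V W \<longleftrightarrow> - q + \<i> *\<^sub>C u = \<pi> (q + \<i> *\<^sub>C u)"
proof
  assume "(u, q) \<in> W \<times> orth_complement t V W"
  then have "\<pi> (\<i> *\<^sub>C u + q) = \<i> *\<^sub>C u - q"
    using W(1) by (intro reflection_apply[OF W P]) (auto intro: tr.subspace_scale)
  then show "- q + \<i> *\<^sub>C u = \<pi> (q + \<i> *\<^sub>C u)" by (simp add: add.commute)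
next
  assume eq: "- q + \<i> *\<^sub>C u = \<pi> (q + \<i> *\<^sub>C u)"
  have "q + \<i> *\<^sub>C u \<in> V" using u q by (simp add: V_closed)
  then obtain w z where wz: "w \<in> W" "z \<in> orth_complement t V W" and s: "q + \<i> *\<^sub>C u = w + z"
    using projector_decomposition[OF P] by blast
  have d: "- q + \<i> *\<^sub>C u = w - z" using eq reflection_apply[OF W P wz] s by simp
  have pw: "w j x = \<i> * u j x \<and> z j x = q j x" for j x
  proof -
    have "q j x + \<i> * u j x = w j x + z j x" "- q j x + \<i> * u j x = w j x - z j x"
      using fun_cong[OF fun_cong[OF s, of j], of x] fun_cong[OF fun_cong[OF d, of j], of x]
      by (simp_all add: cscale_def)
    then show ?thesis by algebra
  qed
  have "u = (- \<i>) *\<^sub>C w" "q = z"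
    by (simp_all add: fun_eq_iff cscale_def pw)
  then show "(u, q) \<in> W \<times> orth_complement t V W"
    using wz tr.subspace_scale[OF W(1) wz(1), of "- \<i>"] by blast
qed

text \<open>Linearity of the projection comes from uniqueness: the sum of two decompositions is a
  decomposition of the sum.\<close>

lemma ex1_reflection:
  assumes W: "tr.subspace W" "W \<subseteq> V" and dec: "\<And>u. u \<in> V \<Longrightarrow> \<exists>w\<in>W. u - w \<in> orth_complement t V W"
  shows "\<exists>!\<pi>. \<pi> \<in> extensional V \<and> linear_map_on V \<pi> \<and>
           orth_projector_on t V W (\<lambda>u. (1/2) *\<^sub>C (u + \<pi> u))"
proof (rule ex_ex1I)
  note sub_orth = subspace_orth_complement[OF W(2)]
  obtain p where p: "\<And>u. u \<in> V \<Longrightarrow> p u \<in> W" "\<And>u. u \<in> V \<Longrightarrow> u - p u \<in> orth_complement t V W"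
    using dec by metis
  have p_eq: "p u = w" if "u \<in> V" "w \<in> W" "u - w \<in> orth_complement t V W" for u w
    by (rule orth_decomposition_unique(1)[OF W p(1) that(2) p(2) that(3)])
      (use that in \<open>simp_all add: algebra_simps\<close>)
  have p_add: "p (u + v) = p u + p v" if "u \<in> V" "v \<in> V" for u v
    using that p tr.subspace_add[OF W(1), of "p u" "p v"]
      tr.subspace_add[OF sub_orth p(2) p(2), of u v]
    by (intro p_eq) (auto simp: V_closed algebra_simps)
  have p_scale: "p (c *\<^sub>C u) = c *\<^sub>C p u" if "u \<in> V" for u c
    using that p tr.subspace_scale[OF W(1), of "p u" c] tr.subspace_scale[OF sub_orth p(2), of u c]
    by (intro p_eq) (auto simp: V_closed tr.scale_right_diff_distrib)
  define \<pi> where "\<pi> = restrict (\<lambda>u. 2 *\<^sub>C p u - u) V"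
  have half: "(1/2) *\<^sub>C (u + \<pi> u) = p u" if "u \<in> V" for u
    using that by (auto simp: \<pi>_def cscale_def fun_eq_iff)
  have "p u \<in> V" if "u \<in> V" for u using p(1)[OF that] W(2) by blast
  then have "linear_map_on V \<pi>" unfolding linear_map_on_def
    by (auto simp: \<pi>_def V_closed p_add p_scale tr.scale_right_diff_distrib tr.scale_right_distrib
        tr.scale_left_commute)
  moreover have "orth_projector_on t V W (\<lambda>u. (1/2) *\<^sub>C (u + \<pi> u))"
    unfolding orth_projector_on_def using p by (simp add: half)
  ultimately show "\<exists>\<pi>. \<pi> \<in> extensional V \<and> linear_map_on V \<pi> \<and>
      orth_projector_on t V W (\<lambda>u. (1/2) *\<^sub>C (u + \<pi> u))"
    by (intro exI[of _ \<pi>]) (simp add: \<pi>_def)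
next
  fix \<pi> \<rho>
  assume \<pi>: "\<pi> \<in> extensional V \<and> linear_map_on V \<pi> \<and>
      orth_projector_on t V W (\<lambda>u. (1/2) *\<^sub>C (u + \<pi> u))"
    and \<rho>: "\<rho> \<in> extensional V \<and> linear_map_on V \<rho> \<and>
      orth_projector_on t V W (\<lambda>u. (1/2) *\<^sub>C (u + \<rho> u))"
  show "\<pi> = \<rho>"
  proof (rule extensionalityI[of _ V])
    fix u assume "u \<in> V"
    then obtain w z where wz: "w \<in> W" "z \<in> orth_complement t V W" and u: "u = w + z"
      using \<pi> by (blast elim: projector_decomposition)
    have "\<pi> (w + z) = w - z" using \<pi> by (intro reflection_apply[OF W _ wz]) blast
    moreover have "\<rho> (w + z) = w - z" using \<rho> by (intro reflection_apply[OF W _ wz]) blast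
    ultimately show "\<pi> u = \<rho> u" using u by simp
  qed (use \<pi> \<rho> in auto)
qed

end


section \<open>The trace spaces\<close>

lemma complex_polys_add:
  assumes "p \<in> complex_polys k" "q \<in> complex_polys k"
  shows "(\<lambda>x. p x + q x) \<in> complex_polys k"
proof -
  obtain c d where
    "\<forall>x. p x = (\<Sum>\<alpha> | sum \<alpha> UNIV \<le> k. c \<alpha> * complex_of_real (\<Prod>i\<in>UNIV. x $ i ^ \<alpha> i))"
    "\<forall>x. q x = (\<Sum>\<alpha> | sum \<alpha> UNIV \<le> k. d \<alpha> * complex_of_real (\<Prod>i\<in>UNIV. x $ i ^ \<alpha> i))"
    using assms unfolding complex_polys_def by blast
  then show ?thesis unfolding complex_polys_def
    by (intro CollectI exI[of _ "\<lambda>\<alpha>. c \<alpha> + d \<alpha>"]) (simp add: algebra_simps sum.distrib)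
qed

lemma complex_polys_cmult:
  assumes "p \<in> complex_polys k"
  shows "(\<lambda>x. a * p x) \<in> complex_polys k"
proof -
  obtain c where
    "\<forall>x. p x = (\<Sum>\<alpha> | sum \<alpha> UNIV \<le> k. c \<alpha> * complex_of_real (\<Prod>i\<in>UNIV. x $ i ^ \<alpha> i))"
    using assms unfolding complex_polys_def by blast
  then show ?thesis unfolding complex_polys_def
    by (intro CollectI exI[of _ "\<lambda>\<alpha>. a * c \<alpha>"]) (simp add: sum_distrib_left mult.assoc)
qed

lemma fe_space_add:
  assumes "u \<in> fe_space k \<Omega> \<T>" "v \<in> fe_space k \<Omega> \<T>"
  shows "(\<lambda>x. u x + v x) \<in> fe_space k \<Omega> \<T>"
proof -
  have "\<exists>p\<in>complex_polys k. \<forall>x\<in>\<tau>. u x + v x = p x" if \<tau>: "\<tau> \<in> \<T>" for \<tau>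
  proof -
    obtain p q where pq: "p \<in> complex_polys k" "q \<in> complex_polys k"
      "\<forall>x\<in>\<tau>. u x = p x" "\<forall>x\<in>\<tau>. v x = q x"
      using assms \<tau> unfolding fe_space_def by blast
    then show ?thesis by (intro bexI[OF _ complex_polys_add[OF pq(1,2)]]) auto
  qed
  then show ?thesis using assms by (auto simp: fe_space_def intro: continuous_on_add)
qed

lemma fe_space_cmult:
  assumes "u \<in> fe_space k \<Omega> \<T>"
  shows "(\<lambda>x. a * u x) \<in> fe_space k \<Omega> \<T>"
proof -
  have "\<exists>p\<in>complex_polys k. \<forall>x\<in>\<tau>. a * u x = p x" if \<tau>: "\<tau> \<in> \<T>" for \<tau>
  proof -
    obtain p where "p \<in> complex_polys k" "\<forall>x\<in>\<tau>. u x = p x"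
      using assms \<tau> unfolding fe_space_def by blast
    then show ?thesis by (intro bexI[OF _ complex_polys_cmult]) auto
  qed
  then show ?thesis using assms by (auto simp: fe_space_def intro: continuous_on_mult_left)
qed

lemma fe_space_zero: "(\<lambda>x. 0) \<in> fe_space k \<Omega> \<T>"
proof -
  have "(\<lambda>x. 0) \<in> complex_polys k"
    unfolding complex_polys_def by (auto intro: exI[of _ "\<lambda>_. 0"])
  then show ?thesis by (auto simp: fe_space_def)
qed

lemma subspace_multi_trace_space: "tr.subspace (multi_trace_space k \<Omega> \<T> J \<Omega>s)"
proof -
  have zero: "0 \<in> fe_trace_space k \<Omega> \<T> \<Gamma>" for \<Gamma>
    unfolding fe_trace_space_def
    by (intro image_eqI[OF _ fe_space_zero]) (auto simp: restr_def fun_eq_iff)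
  have add: "f + g \<in> fe_trace_space k \<Omega> \<T> \<Gamma>"
    if "f \<in> fe_trace_space k \<Omega> \<T> \<Gamma>" "g \<in> fe_trace_space k \<Omega> \<T> \<Gamma>" for f g \<Gamma>
    using that unfolding fe_trace_space_def
    by (auto intro!: image_eqI[OF _ fe_space_add] simp: restr_def fun_eq_iff)
  have cmult: "(\<lambda>x. c * f x) \<in> fe_trace_space k \<Omega> \<T> \<Gamma>"
    if "f \<in> fe_trace_space k \<Omega> \<T> \<Gamma>" for c f \<Gamma>
    using that unfolding fe_trace_space_def
    by (auto intro!: image_eqI[OF _ fe_space_cmult] simp: restr_def fun_eq_iff)
  show ?thesis
    unfolding tr.subspace_def multi_trace_space_def
    by (auto simp: zero add cmult cscale_def fun_eq_iff)
qed

lemma subspace_single_trace_space: "tr.subspace (single_trace_space k \<Omega> \<T> J \<Omega>s)"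
  unfolding tr.subspace_def single_trace_space_def
proof (intro conjI ballI allI, goal_cases)
  case 1
  show ?case by (rule image_eqI[OF _ fe_space_zero]) (auto simp: restr_def fun_eq_iff)
next
  case (2 x y)
  then obtain u v where uv: "u \<in> fe_space k \<Omega> \<T>" "v \<in> fe_space k \<Omega> \<T>"
    "x = (\<lambda>j. if j \<in> {1..J} then restr (frontier (\<Omega>s j)) u else 0)"
    "y = (\<lambda>j. if j \<in> {1..J} then restr (frontier (\<Omega>s j)) v else 0)" by blast
  then show ?case by (intro image_eqI[OF _ fe_space_add[OF uv(1,2)]]) (auto simp: restr_def fun_eq_iff)
next
  case (3 c x)
  then obtain u where "u \<in> fe_space k \<Omega> \<T>"
    "x = (\<lambda>j. if j \<in> {1..J} then restr (frontier (\<Omega>s j)) u else 0)" by blast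
  then show ?case
    by (intro image_eqI[OF _ fe_space_cmult]) (auto simp: restr_def fun_eq_iff cscale_def)
qed

lemma single_trace_space_subset:
  "single_trace_space k \<Omega> \<T> J \<Omega>s \<subseteq> multi_trace_space k \<Omega> \<T> J \<Omega>s"
  by (auto simp: single_trace_space_def multi_trace_space_def fe_trace_space_def)

lemma finite_multi_indices: "finite {\<alpha> :: 'd::finite \<Rightarrow> nat. sum \<alpha> UNIV \<le> k}"
proof (rule finite_subset)
  have "\<alpha> i \<le> sum \<alpha> UNIV" for \<alpha> :: "'d \<Rightarrow> nat" and i by (rule member_le_sum) auto
  then show "{\<alpha> :: 'd \<Rightarrow> nat. sum \<alpha> UNIV \<le> k} \<subseteq> PiE UNIV (\<lambda>_. {..k})"
    by (auto simp: PiE_UNIV_domain intro: le_trans)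
  show "finite (PiE (UNIV :: 'd set) (\<lambda>_. {..k}))" by (rule finite_PiE) auto
qed

text \<open>Cells overlap along their faces, so every point is assigned to one chosen cell containing it.
  Multiplying the monomials by the indicators of the resulting disjoint pieces gives a finite spanning
  set; these generators are in general discontinuous, hence
  not traces of finite element functions, but a spanning set need not lie in the space it covers.\<close>

lemma single_trace_space_finitely_spanned:
  fixes \<Omega> :: "(real ^ 'd) set"
  assumes "finite \<T>" "closure \<Omega> = \<Union>\<T>"
  obtains G where "finite G" "single_trace_space k \<Omega> \<T> J \<Omega>s \<subseteq> tr.span G"
proof -
  define A where "A = {\<alpha> :: 'd \<Rightarrow> nat. sum \<alpha> UNIV \<le> k}"
  have finA: "finite A" unfolding A_def by (rule finite_multi_indices)
  have "\<forall>x\<in>closure \<Omega>. \<exists>\<tau>\<in>\<T>. x \<in> \<tau>" using assms(2) by blast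
  then obtain cell where cell: "\<And>x. x \<in> closure \<Omega> \<Longrightarrow> cell x \<in> \<T> \<and> x \<in> cell x" by metis
  define \<phi> :: "(real ^ 'd) set \<times> ('d \<Rightarrow> nat) \<Rightarrow> real ^ 'd \<Rightarrow> complex" where
    "\<phi> = (\<lambda>(\<tau>, \<alpha>) x. if x \<in> closure \<Omega> \<and> cell x = \<tau>
                         then complex_of_real (\<Prod>i\<in>UNIV. x $ i ^ \<alpha> i) else 0)"
  define trace where
    "trace v j = (if j \<in> {1..J} then restr (frontier (\<Omega>s j)) v else 0)" for v and j :: nat
  define G where "G = (trace \<circ> \<phi>) ` (\<T> \<times> A)"
  have finG: "finite G" unfolding G_def using assms(1) finA by simp
  have "trace v \<in> tr.span G" if v: "v \<in> fe_space k \<Omega> \<T>" for v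
  proof -
    have "\<forall>\<tau>\<in>\<T>. \<exists>c. \<forall>x\<in>\<tau>. v x = (\<Sum>\<alpha>\<in>A. c \<alpha> * complex_of_real (\<Prod>i\<in>UNIV. x $ i ^ \<alpha> i))"
    proof
      fix \<tau> assume "\<tau> \<in> \<T>"
      then obtain p where "p \<in> complex_polys k" "\<forall>x\<in>\<tau>. v x = p x"
        using v unfolding fe_space_def by blast
      then show "\<exists>c. \<forall>x\<in>\<tau>. v x = (\<Sum>\<alpha>\<in>A. c \<alpha> * complex_of_real (\<Prod>i\<in>UNIV. x $ i ^ \<alpha> i))"
        unfolding complex_polys_def A_def by auto
    qed
    then obtain c where c: "\<And>\<tau> x. \<tau> \<in> \<T> \<Longrightarrow> x \<in> \<tau> \<Longrightarrow>
        v x = (\<Sum>\<alpha>\<in>A. c \<tau> \<alpha> * complex_of_real (\<Prod>i\<in>UNIV. x $ i ^ \<alpha> i))" by metis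
    have v_eq: "v x = (\<Sum>(\<tau>, \<alpha>)\<in>\<T> \<times> A. c \<tau> \<alpha> * \<phi> (\<tau>, \<alpha>) x)" for x
    proof (cases "x \<in> closure \<Omega>")
      case True
      have "(\<Sum>(\<tau>, \<alpha>)\<in>\<T> \<times> A. c \<tau> \<alpha> * \<phi> (\<tau>, \<alpha>) x) =
          (\<Sum>\<tau>\<in>\<T>. if cell x = \<tau>
             then (\<Sum>\<alpha>\<in>A. c \<tau> \<alpha> * complex_of_real (\<Prod>i\<in>UNIV. x $ i ^ \<alpha> i)) else 0)"
        unfolding sum.cartesian_product[symmetric] using True
        by (intro sum.cong) (auto simp: \<phi>_def)
      also have "\<dots> = v x" using c[of "cell x" x] cell[OF True] assms(1) by (simp add: sum.delta)
      finally show ?thesis ..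
    next
      case False
      then have "v x = 0" using v unfolding fe_space_def by blast
      with False show ?thesis by (auto simp: \<phi>_def intro!: sum.neutral[symmetric])
    qed
    have sum_apply2: "(\<Sum>i\<in>I. f i) j x = (\<Sum>i\<in>I. f i j x)"
      for I and f :: "(real ^ 'd) set \<times> ('d \<Rightarrow> nat) \<Rightarrow> 'd traces" and j x
      by (induction I rule: infinite_finite_induct) auto
    have "trace v = (\<Sum>i\<in>\<T> \<times> A. (case i of (\<tau>, \<alpha>) \<Rightarrow> c \<tau> \<alpha>) *\<^sub>C trace (\<phi> i))"
    proof (intro ext)
      fix j x
      show "trace v j x = (\<Sum>i\<in>\<T> \<times> A. (case i of (\<tau>, \<alpha>) \<Rightarrow> c \<tau> \<alpha>) *\<^sub>C trace (\<phi> i)) j x"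
        unfolding sum_apply2
        by (auto simp: trace_def restr_def cscale_def v_eq case_prod_unfold)
    qed
    also have "\<dots> \<in> tr.span G"
      by (intro tr.span_sum tr.span_scale tr.span_base) (auto simp: G_def)
    finally show ?thesis .
  qed
  then have "single_trace_space k \<Omega> \<T> J \<Omega>s \<subseteq> tr.span G"
    unfolding single_trace_space_def trace_def by auto
  with finG show ?thesis by (rule that)
qed


section \<open>The reflection on the multi-trace space\<close>

theorem lemma6p2:
  fixes \<Omega> :: "(real ^ 'd) set" and \<T> :: "(real ^ 'd) set set"
    and \<Omega>s :: "nat \<Rightarrow> (real ^ 'd) set" and J k :: nat
    and t :: "'d traces \<Rightarrow> 'd traces \<Rightarrow> complex"
  defines "V \<equiv> multi_trace_space k \<Omega> \<T> J \<Omega>s"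
    and "W \<equiv> single_trace_space k \<Omega> \<T> J \<Omega>s"
  assumes "CARD('d) \<in> {1, 2, 3}"
    and "k \<ge> 1"
    and "polyhedral_open \<Omega>" and "connected \<Omega>"
    and "simplicial_mesh \<Omega> \<T>"
    and "resolved_partition \<Omega> \<T> J \<Omega>s"
    and "scalar_product_on V t"
  shows
    "(\<exists>!\<pi>. \<pi> \<in> extensional V \<and> linear_map_on V \<pi> \<and>
        orth_projector_on t V W (\<lambda>u. (1/2) *\<^sub>C (u + \<pi> u))) \<and>
     (\<forall>\<pi>. linear_map_on V \<pi> \<and> orth_projector_on t V W (\<lambda>u. (1/2) *\<^sub>C (u + \<pi> u)) \<longrightarrow>
        (\<forall>u\<in>V. \<pi> (\<pi> u) = u) \<and>
        (\<forall>u\<in>V. sp_norm t (\<pi> u) = sp_norm t u) \<and>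
        (\<forall>u\<in>V. \<forall>q\<in>V.
           (u, q) \<in> W \<times> orth_complement t V W \<longleftrightarrow> - q + \<i> *\<^sub>C u = \<pi> (q + \<i> *\<^sub>C u)))"
proof -
  have W: "tr.subspace W" "W \<subseteq> V"
    unfolding W_def V_def
    by (rule subspace_single_trace_space, rule single_trace_space_subset)
  interpret trace_inner_product V t
    by unfold_locales (use assms subspace_multi_trace_space in auto)
  have "finite \<T>" "closure \<Omega> = \<Union>\<T>"
    using \<open>simplicial_mesh \<Omega> \<T>\<close> by (auto simp: simplicial_mesh_def triangulation_def)
  then obtain G where "finite G" "W \<subseteq> tr.span G"
    unfolding W_def by (rule single_trace_space_finitely_spanned)
  then have "\<exists>w\<in>W. u - w \<in> orth_complement t V W" if "u \<in> V" for u
    using ex_orth_decomposition[OF W] that by blast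
  from ex1_reflection[OF W this] show ?thesis
    using reflection_involutive[OF W] reflection_isometry[OF W] reflection_transmission_iff[OF W]
    by blast
qed

end
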